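(* Let $\nu>0$, $\mu>0$, $c>0$, and let $N_0$ be a constant. Then the solution $N(t)$, $t>0$, of the integral equation $$N(t)-N_0\,t^{\mu-1}=-c^{\nu}\;{}_0D_t^{-\nu}N(t)$$ is given by $$N(t)=N_0\,\Gamma(\mu)\,t^{\mu-1}E_{\nu,\mu}(-c^{\nu}t^{\nu}).$$
   Context: The Riemann-Liouville fractional integral of order $\nu>0$ with lower limit $0$ is ${}_0D_t^{-\nu}f(t)=\frac{1}{\Gamma(\nu)}\int_0^t f(u)(t-u)^{\nu-1}\,du$. The generalized Mittag-Leffler function is $E_{\alpha,\beta}(z)=\sum_{n=0}^{\infty}\frac{z^n}{\Gamma(\alpha n+\beta)}$ for $\alpha>0$. The unknown $N$ is a real-valued function of $t>0$, locally integrable on $[0,\infty)$, and $N_0$ is a real constant. *)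

theory Defs
  imports "HOL-Analysis.Analysis"
begin

definition locally_integrable_on :: "(real \<Rightarrow> real) \<Rightarrow> real set \<Rightarrow> bool"
    (infixr "locally'_integrable'_on" 46) where
  "f locally_integrable_on S \<longleftrightarrow>
     (\<forall>K. compact K \<and> K \<subseteq> S \<longrightarrow> f absolutely_integrable_on K)"

text \<open>
  The Bochner integral is total, with value 0 on non-integrable functions, so the existence of
  the Riemann-Liouville integral at a point is a separate predicate.  The value \<open>0\<close> of
  \<open>(t - u) powr (\<nu> - 1)\<close> at \<open>u = t\<close> is irrelevant, as a single point is a null set.
\<close>

definition RL_integral_exists :: "real \<Rightarrow> (real \<Rightarrow> real) \<Rightarrow> real \<Rightarrow> bool" where
  "RL_integral_exists \<nu> f t \<longleftrightarrow>
     (\<lambda>u. f u * (t - u) powr (\<nu> - 1)) absolutely_integrable_on {0..t}"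

definition RL_integral :: "real \<Rightarrow> (real \<Rightarrow> real) \<Rightarrow> real \<Rightarrow> real" where
  "RL_integral \<nu> f t =
     1 / Gamma \<nu> * (LINT u:{0..t}|lebesgue. f u * (t - u) powr (\<nu> - 1))"

definition mittag_leffler :: "real \<Rightarrow> real \<Rightarrow> real \<Rightarrow> real" where
  "mittag_leffler \<alpha> \<beta> z = (\<Sum>n. z ^ n / Gamma (\<alpha> * real n + \<beta>))"

end

theory Submission
  imports Defs "HOL-Real_Asymp.Real_Asymp"
begin

text \<open>
  Write \<open>I\<close> for the Riemann-Liouville integral of order \<open>\<nu>\<close>. The equivalence has two independent
  halves.

  \<^emph>\<open>Existence.\<close> By Euler's Beta integral, fractional integration of order \<open>\<rho>\<close> maps
  \<open>u powr (a - 1) / Gamma a\<close> to \<open>t powr (a + \<rho> - 1) / Gamma (a + \<rho>)\<close>. Applied to every term of the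
  series of \<open>u powr (\<mu> - 1) * mittag_leffler \<nu> \<mu> (z * u powr \<nu>)\<close> with \<open>\<rho> = \<nu>\<close>, it yields a series whose
  product with \<open>z\<close> is the original one without its first term, so the closed form solves the equation (\<open>RL_integral_mittag_leffler\<close>,
  \<open>mittag_leffler_recurrence\<close>, \<open>mittag_leffler_solves\<close>). Convergence rests on the growth of the Gamma
  function, which follows from its logarithmic convexity.

  \<^emph>\<open>Uniqueness.\<close> The difference \<open>D\<close> of two solutions is locally integrable and satisfies
  \<open>D = - k * I D\<close> with \<open>k = c powr \<nu>\<close>. The kernel is singular at \<open>u = t\<close> if \<open>\<nu> < 1\<close> and \<open>D\<close> may be
  unbounded near \<open>0\<close>, so the supremum norm is unsuited to a contraction argument; but in the \<open>L\<^sup>1\<close> norm with weight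
  \<open>exp (- s * t)\<close> the operator \<open>k * I\<close> has norm at most \<open>k / s powr \<nu>\<close>, which is \<open>1/2\<close> for suitable \<open>s\<close>.
  Hence \<open>D = 0\<close> almost everywhere, and then everywhere on \<open>t > 0\<close> because \<open>I D\<close> ignores null sets
  (\<open>homogeneous_abel_volterra_zero\<close>).
\<close>

section \<open>Growth of the Gamma function and convergence of the Mittag-Leffler series\<close>

text \<open>
  Convexity of \<open>ln \<circ> Gamma\<close> turns the exact unit-step increment \<open>ln (a - 1)\<close>, given by the
  functional equation, into a lower bound for the increment over an arbitrary step \<open>\<nu>\<close>. It supplies
  the growth of \<open>Gamma\<close> along arithmetic progressions.
\<close>

lemma Gamma_shift_growth:
  fixes a \<nu> :: real
  assumes "a > 1" "\<nu> > 0"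
  shows "(a - 1) powr \<nu> * Gamma a \<le> Gamma (a + \<nu>)"
proof -
  let ?f = "ln \<circ> Gamma :: real \<Rightarrow> real"
  have pos: "Gamma (a - 1) > 0" "Gamma a > 0" "Gamma (a + \<nu>) > 0"
    using assms by (auto intro!: Gamma_real_pos)
  have "Gamma a = (a - 1) * Gamma (a - 1)"
    using Gamma_plus1[of "a - 1"] assms nonpos_Ints_nonpos[of "a - 1"] by force
  hence step: "?f a = ln (a - 1) + ?f (a - 1)"
    using assms pos(1) by (simp add: ln_mult_pos)
  \<comment> \<open>The chord of a convex function over \<open>[a - 1, a]\<close> is no steeper than the one over \<open>[a, a + \<nu>]\<close>.\<close>
  have "(?f (a - 1) - ?f a) / ((a - 1) - a) \<le> (?f a - ?f (a + \<nu>)) / (a - (a + \<nu>))"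
    using convex_on_slope_le[OF log_convex_Gamma_real, of "a - 1" "a + \<nu>" a] assms by simp
  hence "\<nu> * ln (a - 1) + ln (Gamma a) \<le> ln (Gamma (a + \<nu>))"
    using step assms by (simp add: field_simps)
  hence "ln ((a - 1) powr \<nu> * Gamma a) \<le> ln (Gamma (a + \<nu>))"
    using assms pos(2) by (simp add: ln_mult_pos ln_powr)
  thus ?thesis
    using assms pos by (subst (asm) ln_le_cancel_iff) auto
qed

text \<open>
  By the growth bound, consecutive denominators have ratio at least \<open>(\<alpha> n + \<beta> - 1) powr \<alpha>\<close>, which
  tends to infinity, so the ratio test applies for every \<open>z\<close>.
\<close>

lemma summable_abs_mittag_leffler:
  fixes \<alpha> \<beta> z :: real
  assumes "\<alpha> > 0" "\<beta> > 0"
  shows "summable (\<lambda>n. \<bar>z ^ n / Gamma (\<alpha> * real n + \<beta>)\<bar>)"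
proof -
  let ?r = "\<lambda>n. \<alpha> * real n + \<beta>"
  have "filterlim (\<lambda>n. (?r n - 1) powr \<alpha>) at_top sequentially"
    using assms by real_asymp
  hence "eventually (\<lambda>n. (?r n - 1) powr \<alpha> \<ge> 2 * \<bar>z\<bar> + 1) sequentially"
    by (auto simp: filterlim_at_top)
  moreover have "eventually (\<lambda>n. ?r n > 1) sequentially"
    using assms by real_asymp
  ultimately have "eventually (\<lambda>n. (?r n - 1) powr \<alpha> \<ge> 2 * \<bar>z\<bar> + 1 \<and> ?r n > 1) sequentially"
    by (rule eventually_conj)
  then obtain n0 where n0: "\<And>n. n \<ge> n0 \<Longrightarrow> (?r n - 1) powr \<alpha> \<ge> 2 * \<bar>z\<bar> + 1 \<and> ?r n > 1"
    by (auto simp: eventually_sequentially)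
  show ?thesis
  proof (rule summable_ratio_test[where c = "1/2" and N = n0])
    fix n assume n: "n \<ge> n0"
    have G: "Gamma (?r n) > 0" "Gamma (?r (Suc n)) > 0"
      using assms by (auto intro!: Gamma_real_pos add_nonneg_pos)
    have "2 * \<bar>z\<bar> * Gamma (?r n) \<le> (?r n - 1) powr \<alpha> * Gamma (?r n)"
      using n0[OF n] G by (intro mult_right_mono) auto
    also have "\<dots> \<le> Gamma (?r n + \<alpha>)"
      using n0[OF n] assms by (intro Gamma_shift_growth) auto
    also have "?r n + \<alpha> = ?r (Suc n)"
      by (simp add: algebra_simps)
    finally have "\<bar>z\<bar> / Gamma (?r (Suc n)) \<le> 1 / 2 * (1 / Gamma (?r n))"
      using G by (simp add: field_simps)
    hence "\<bar>z\<bar> ^ n * (\<bar>z\<bar> / Gamma (?r (Suc n))) \<le> \<bar>z\<bar> ^ n * (1 / 2 * (1 / Gamma (?r n)))"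
      by (rule mult_left_mono) simp
    thus "norm \<bar>z ^ Suc n / Gamma (?r (Suc n))\<bar> \<le> 1 / 2 * norm \<bar>z ^ n / Gamma (?r n)\<bar>"
      using G by (simp add: abs_mult power_abs mult_ac)
  qed simp
qed

corollary summable_mittag_leffler:
  fixes \<alpha> \<beta> z :: real
  assumes "\<alpha> > 0" "\<beta> > 0"
  shows "summable (\<lambda>n. z ^ n / Gamma (\<alpha> * real n + \<beta>))"
  by (rule summable_rabs_cancel[OF summable_abs_mittag_leffler[OF assms]])

text \<open>
  Splitting off the term \<open>n = 0\<close> shifts the index of the series, which raises \<open>\<beta>\<close> by \<open>\<alpha>\<close>.
  This is the integral equation of the theorem at the level of power series.
\<close>

lemma mittag_leffler_recurrence:
  fixes \<alpha> \<beta> z :: real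
  assumes "\<alpha> > 0" "\<beta> > 0"
  shows "mittag_leffler \<alpha> \<beta> z = 1 / Gamma \<beta> + z * mittag_leffler \<alpha> (\<alpha> + \<beta>) z"
proof -
  let ?f = "\<lambda>n. z ^ n / Gamma (\<alpha> * real n + \<beta>)"
  have "summable ?f"
    by (rule summable_mittag_leffler) (use assms in auto)
  hence "suminf ?f = ?f 0 + (\<Sum>n. ?f (Suc n))"
    using suminf_split_head[of ?f] by simp
  also have "(\<Sum>n. ?f (Suc n)) = (\<Sum>n. z * (z ^ n / Gamma (\<alpha> * real n + (\<alpha> + \<beta>))))"
    by (simp add: algebra_simps)
  also have "\<dots> = z * mittag_leffler \<alpha> (\<alpha> + \<beta>) z"
    unfolding mittag_leffler_def
    by (rule suminf_mult, rule summable_mittag_leffler) (use assms in auto)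
  finally show ?thesis by (simp add: mittag_leffler_def)
qed

section \<open>Elementary properties of the Riemann-Liouville integral\<close>

text \<open>
  The value of the integrand at the lower limit does not matter. This is needed because the
  integral equation says nothing about the unknown at \<open>0\<close>.
\<close>

lemma RL_integral_cong:
  assumes "\<And>u. u > 0 \<Longrightarrow> f u = g u" and "RL_integral_exists \<nu> f t"
  shows "RL_integral_exists \<nu> g t" and "RL_integral \<nu> g t = RL_integral \<nu> f t"
proof -
  let ?f = "\<lambda>u. f u * (t - u) powr (\<nu> - 1)" and ?g = "\<lambda>u. g u * (t - u) powr (\<nu> - 1)"
  have fg: "?g u = ?f u" if "u \<in> {0..t} - {0}" for u
    using that assms(1) by simp
  have f: "?f absolutely_integrable_on {0..t}"
    using assms(2) by (simp add: RL_integral_exists_def)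
  have g: "?g absolutely_integrable_on {0..t}"
    using absolutely_integrable_spike[OF f negligible_sing fg] .
  thus "RL_integral_exists \<nu> g t"
    by (simp add: RL_integral_exists_def)
  have "integral {0..t} ?g = integral {0..t} ?f"
    using fg by (intro integral_spike[OF negligible_sing[of 0]]) metis
  thus "RL_integral \<nu> g t = RL_integral \<nu> f t"
    using set_lebesgue_integral_eq_integral(2)[OF f] set_lebesgue_integral_eq_integral(2)[OF g]
    by (simp add: RL_integral_def)
qed

lemma RL_integral_diff:
  assumes "RL_integral_exists \<nu> f t" "RL_integral_exists \<nu> g t"
  shows "RL_integral_exists \<nu> (\<lambda>u. f u - g u) t"
    and "RL_integral \<nu> (\<lambda>u. f u - g u) t = RL_integral \<nu> f t - RL_integral \<nu> g t"
  using assms set_integral_diff[of lebesgue "{0..t}" "\<lambda>u. f u * (t - u) powr (\<nu> - 1)" "\<lambda>u. g u * (t - u) powr (\<nu> - 1)"]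
  by (simp_all add: RL_integral_exists_def RL_integral_def algebra_simps)

lemma RL_integral_cmult:
  shows "RL_integral_exists \<nu> f t \<Longrightarrow> RL_integral_exists \<nu> (\<lambda>u. c * f u) t"
    and "RL_integral \<nu> (\<lambda>u. c * f u) t = c * RL_integral \<nu> f t"
  by (simp_all add: RL_integral_exists_def RL_integral_def mult.assoc)

text \<open>
  For order \<open>1\<close> the kernel \<open>(t - u) powr 0\<close> is constantly \<open>1\<close>, except at \<open>u = t\<close>, so the
  Riemann-Liouville integral is the ordinary one.
\<close>

lemma locally_integrable_if_RL_integral_exists_1:
  assumes "\<And>t. t > 0 \<Longrightarrow> RL_integral_exists 1 f t"
  shows "f locally_integrable_on {0..}"
  unfolding locally_integrable_on_def
proof (intro allI impI, elim conjE)
  fix K :: "real set" assume K: "compact K" "K \<subseteq> {0..}"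
  obtain t where t: "t > 0" "K \<subseteq> {0..t}"
  proof -
    obtain b where "\<And>x. x \<in> K \<Longrightarrow> norm x \<le> b"
      using compact_imp_bounded[OF K(1)] by (auto simp: bounded_iff)
    hence "K \<subseteq> {0..max b 1}" using K(2) by force
    thus ?thesis using that[of "max b 1"] by simp
  qed
  have "(\<lambda>u. f u * (t - u) powr (1 - 1)) absolutely_integrable_on {0..t}"
    using assms[OF t(1)] by (simp add: RL_integral_exists_def)
  hence "f absolutely_integrable_on {0..t}"
    by (rule absolutely_integrable_spike[OF _ negligible_sing[of t]]) auto
  thus "f absolutely_integrable_on K"
    by (rule set_integrable_subset) (use t K in \<open>auto intro: lmeasurable_compact fmeasurableD\<close>)
qed

section \<open>Fractional integrals of Mittag-Leffler functions\<close>

lemma beta_integral_Icc: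
  fixes a b t :: real
  assumes "a > 0" "b > 0" "t > 0"
  shows "(\<lambda>u. u powr (a - 1) * (t - u) powr (b - 1)) absolutely_integrable_on {0..t}"
    and "(LINT u:{0..t}|lebesgue. u powr (a - 1) * (t - u) powr (b - 1))
           = t powr (a + b - 1) * Beta a b"
proof -
  let ?f = "\<lambda>u. u powr (a - 1) * (1 - u) powr (b - 1)"
  \<comment> \<open>Substitute \<open>u = t * v\<close> in the Beta integral over the unit interval.\<close>
  have "((\<lambda>u. ?f ((1/t) * u)) has_integral (1 / \<bar>1/t\<bar>) *\<^sub>R Beta a b) ((\<lambda>u. u / (1/t)) ` {0..1})"
    using assms by (intro has_integral_stretch_real has_integral_Beta_real) auto
  also have "(\<lambda>u. u / (1/t)) ` {0..1} = {0..t}"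
    using assms image_mult_atLeastAtMost[of t 0 1] by (simp add: mult.commute)
  finally have "((\<lambda>u. t powr (a + b - 2) * ?f (u / t)) has_integral t powr (a + b - 2) * (t * Beta a b)) {0..t}"
    using assms by (intro has_integral_mult_right) simp
  moreover have "t powr (a + b - 2) * ?f (u / t) = u powr (a - 1) * (t - u) powr (b - 1)"
    if "u \<in> {0..t}" for u
  proof -
    have "1 - u / t = (t - u) / t"
      using assms by (simp add: field_simps)
    moreover have "t powr (a + b - 2) = t powr (a - 1) * t powr (b - 1)"
      using assms by (simp flip: powr_add)
    ultimately show ?thesis
      using that assms by (simp add: powr_divide)
  qed
  moreover have "t powr (a + b - 2) * (t * Beta a b) = t powr (a + b - 1) * Beta a b"
    using assms powr_add[of t "a + b - 2" 1] by simp
  ultimately have *: "((\<lambda>u. u powr (a - 1) * (t - u) powr (b - 1)) has_integral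
      t powr (a + b - 1) * Beta a b) {0..t}"
    by (metis (no_types, lifting) has_integral_eq)
  show ai: "(\<lambda>u. u powr (a - 1) * (t - u) powr (b - 1)) absolutely_integrable_on {0..t}"
    by (rule nonnegative_absolutely_integrable_1) (use * in auto)
  show "(LINT u:{0..t}|lebesgue. u powr (a - 1) * (t - u) powr (b - 1)) = t powr (a + b - 1) * Beta a b"
    using set_lebesgue_integral_eq_integral(2)[OF ai] * by (simp add: integral_unique)
qed

text \<open>
  Each power of \<open>u\<close> is integrated by the Beta integral; the interchange of sum and integral is
  justified by absolute convergence, as the integrals of the absolute values again form a convergent
  Mittag-Leffler series. The order \<open>\<rho>\<close> is independent of \<open>\<nu>\<close> so that \<open>\<rho> = \<nu>\<close> gives the integral equation
  and \<open>\<rho> = 1\<close> local integrability.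
\<close>

lemma RL_integral_mittag_leffler:
  fixes \<nu> \<mu> \<rho> z t :: real
  assumes "\<nu> > 0" "\<mu> > 0" "\<rho> > 0" "t > 0"
  shows "RL_integral_exists \<rho> (\<lambda>u. u powr (\<mu> - 1) * mittag_leffler \<nu> \<mu> (z * u powr \<nu>)) t"
    and "RL_integral \<rho> (\<lambda>u. u powr (\<mu> - 1) * mittag_leffler \<nu> \<mu> (z * u powr \<nu>)) t
           = t powr (\<mu> + \<rho> - 1) * mittag_leffler \<nu> (\<mu> + \<rho>) (z * t powr \<nu>)"
proof -
  define F where "F = (\<lambda>u. u powr (\<mu> - 1) * mittag_leffler \<nu> \<mu> (z * u powr \<nu>))"
  define a where "a = (\<lambda>n. \<nu> * real n + \<mu>)"
  define C where "C = (\<lambda>n. z ^ n / Gamma (a n))"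
  define p where "p = (\<lambda>n u. u powr (a n - 1) * (t - u) powr (\<rho> - 1))"
  define f where "f = (\<lambda>n u. indicator {0..t} u *\<^sub>R (C n * p n u))"
  have a: "a n > 0" for n
    using assms by (auto simp: a_def intro: add_nonneg_pos)
  have Gpos: "Gamma (a n) > 0" "Gamma (a n + \<rho>) > 0" for n
    using a[of n] assms by (auto intro!: Gamma_real_pos)
  \<comment> \<open>At \<open>u = 0\<close> both sides vanish, because \<open>0 powr x = 0\<close> for every \<open>x\<close>.\<close>
  have pow: "C n * u powr (a n - 1) = u powr (\<mu> - 1) * ((z * u powr \<nu>) ^ n / Gamma (\<nu> * real n + \<mu>))"
    if "u \<ge> 0" for n u
  proof (cases "u = 0")
    case False
    hence "u powr (a n - 1) = u powr (\<mu> - 1) * (u powr \<nu>) ^ n"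
      using that by (simp add: a_def powr_power powr_add[symmetric] algebra_simps)
    thus ?thesis
      by (simp add: C_def a_def power_mult_distrib)
  qed auto
  \<comment> \<open>The numerator of \<open>Beta (a n) \<rho>\<close> cancels the denominator of \<open>C n\<close>; what is left is a term
    of the Mittag-Leffler series with second index raised by \<open>\<rho>\<close>.\<close>
  have pow_t: "C n * (t powr (a n + \<rho> - 1) * Beta (a n) \<rho>)
      = Gamma \<rho> * t powr (\<mu> + \<rho> - 1) * ((z * t powr \<nu>) ^ n / Gamma (\<nu> * real n + (\<mu> + \<rho>)))" for n
  proof -
    have "t powr (a n + \<rho> - 1) = t powr (\<mu> + \<rho> - 1) * (t powr \<nu>) ^ n"
      using assms by (simp add: a_def powr_power powr_add[symmetric] algebra_simps)
    moreover have shift: "\<nu> * real n + (\<mu> + \<rho>) = a n + \<rho>"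
      by (simp add: a_def)
    ultimately show ?thesis
      unfolding shift using Gpos[of n] by (simp add: C_def Beta_def power_mult_distrib)
  qed
  have int_p: "set_integrable lebesgue {0..t} (p n)"
    and LINT_p: "(LINT u:{0..t}|lebesgue. p n u) = t powr (a n + \<rho> - 1) * Beta (a n) \<rho>" for n
    unfolding p_def using beta_integral_Icc[OF a assms(3,4)] by auto
  have int_f: "integrable lebesgue (f n)" for n
    using set_integrable_mult_right[of "C n" lebesgue "{0..t}" "p n"] int_p[of n]
    unfolding f_def set_integrable_def by simp
  have LINT_f: "integral\<^sup>L lebesgue (f n) = C n * (t powr (a n + \<rho> - 1) * Beta (a n) \<rho>)" for n
    using LINT_p[of n] by (simp add: f_def set_lebesgue_integral_def mult.left_commute)
  have norm_f: "norm (f n u) = indicator {0..t} u *\<^sub>R (\<bar>C n\<bar> * p n u)" for n u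
    by (simp add: f_def p_def abs_mult indicator_def)
  have LINT_norm_f: "(\<integral>u. norm (f n u) \<partial>lebesgue) = \<bar>C n\<bar> * (t powr (a n + \<rho> - 1) * Beta (a n) \<rho>)" for n
    unfolding norm_f using LINT_p[of n] by (simp add: set_lebesgue_integral_def mult.left_commute)
  have Beta_pos: "t powr (a n + \<rho> - 1) * Beta (a n) \<rho> \<ge> 0" for n
    using Gpos[of n] assms by (simp add: Beta_def less_imp_le)
  have sum_pt: "summable (\<lambda>n. norm (f n u))" for u
  proof (cases "u \<in> {0..t}")
    case True
    have "norm (f n u) = (t - u) powr (\<rho> - 1) * u powr (\<mu> - 1) *
        \<bar>(z * u powr \<nu>) ^ n / Gamma (\<nu> * real n + \<mu>)\<bar>" for n
    proof -
      have "f n u = (C n * u powr (a n - 1)) * (t - u) powr (\<rho> - 1)"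
        using True by (simp add: f_def p_def)
      also have "\<dots> = u powr (\<mu> - 1) * ((z * u powr \<nu>) ^ n / Gamma (\<nu> * real n + \<mu>)) * (t - u) powr (\<rho> - 1)"
        using True by (subst pow) auto
      finally show ?thesis
        by (simp add: abs_mult mult_ac)
    qed
    thus ?thesis
      using summable_abs_mittag_leffler[of \<nu> \<mu> "z * u powr \<nu>"] assms
      by (simp only: summable_mult)
  next
    case False
    thus ?thesis by (simp add: f_def)
  qed
  have sum_int: "summable (\<lambda>n. \<integral>u. norm (f n u) \<partial>lebesgue)"
  proof -
    have "(\<integral>u. norm (f n u) \<partial>lebesgue) = Gamma \<rho> * t powr (\<mu> + \<rho> - 1) *
        \<bar>(z * t powr \<nu>) ^ n / Gamma (\<nu> * real n + (\<mu> + \<rho>))\<bar>" for n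
    proof -
      have "\<bar>C n\<bar> * (t powr (a n + \<rho> - 1) * Beta (a n) \<rho>)
          = \<bar>C n * (t powr (a n + \<rho> - 1) * Beta (a n) \<rho>)\<bar>"
        using Beta_pos[of n] by (simp only: abs_mult[of "C n"] abs_of_nonneg)
      thus ?thesis
        unfolding LINT_norm_f pow_t using Gamma_real_pos[OF assms(3)] by (simp add: abs_mult)
    qed
    thus ?thesis
      using summable_abs_mittag_leffler[of \<nu> "\<mu> + \<rho>" "z * t powr \<nu>"] assms
      by (simp only: summable_mult)
  qed
  have suminf_f: "(\<Sum>n. f n u) = indicator {0..t} u *\<^sub>R (F u * (t - u) powr (\<rho> - 1))" for u
  proof (cases "u \<in> {0..t}")
    case True
    have s: "summable (\<lambda>n. (z * u powr \<nu>) ^ n / Gamma (\<nu> * real n + \<mu>))"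
      by (rule summable_mittag_leffler) (use assms in auto)
    have "f n u = ((t - u) powr (\<rho> - 1) * u powr (\<mu> - 1)) *
        ((z * u powr \<nu>) ^ n / Gamma (\<nu> * real n + \<mu>))" for n
    proof -
      have "f n u = (t - u) powr (\<rho> - 1) * (C n * u powr (a n - 1))"
        using True by (simp add: f_def p_def)
      thus ?thesis
        using True pow[of u n] by (simp only: atLeastAtMost_iff mult.assoc)
    qed
    hence "(\<Sum>n. f n u) = ((t - u) powr (\<rho> - 1) * u powr (\<mu> - 1)) * mittag_leffler \<nu> \<mu> (z * u powr \<nu>)"
      using suminf_mult[OF s] by (simp add: mittag_leffler_def)
    thus ?thesis
      using True by (simp add: F_def mult_ac)
  qed (simp add: f_def)
  note AE = AE_I2[of lebesgue, OF sum_pt]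
  show "RL_integral_exists \<rho> F t"
    using integrable_suminf[OF int_f AE sum_int]
    unfolding suminf_f RL_integral_exists_def set_integrable_def .
  have s: "summable (\<lambda>n. (z * t powr \<nu>) ^ n / Gamma (\<nu> * real n + (\<mu> + \<rho>)))"
    by (rule summable_mittag_leffler) (use assms in auto)
  have "(LINT u:{0..t}|lebesgue. F u * (t - u) powr (\<rho> - 1)) = (\<Sum>n. integral\<^sup>L lebesgue (f n))"
    using integral_suminf[OF int_f AE sum_int] unfolding suminf_f set_lebesgue_integral_def .
  also have "\<dots> = Gamma \<rho> * t powr (\<mu> + \<rho> - 1) * mittag_leffler \<nu> (\<mu> + \<rho>) (z * t powr \<nu>)"
    unfolding LINT_f pow_t mittag_leffler_def by (rule suminf_mult[OF s])
  finally show "RL_integral \<rho> F t = t powr (\<mu> + \<rho> - 1) * mittag_leffler \<nu> (\<mu> + \<rho>) (z * t powr \<nu>)"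
    using Gamma_real_pos[OF assms(3)] by (simp add: RL_integral_def)
qed

text \<open>
  With \<open>\<rho> = \<nu>\<close>, integrating the Mittag-Leffler profile raises its second index from \<open>\<mu>\<close> to
  \<open>\<mu> + \<nu>\<close>, and the recurrence expresses the result through the profile itself.
\<close>

lemma mittag_leffler_solves:
  fixes \<nu> \<mu> k N\<^sub>0 :: real and M :: "real \<Rightarrow> real"
  assumes \<nu>: "\<nu> > 0" and \<mu>: "\<mu> > 0"
    and M: "\<And>t. t > 0 \<Longrightarrow> M t = N\<^sub>0 * Gamma \<mu> * t powr (\<mu> - 1) * mittag_leffler \<nu> \<mu> (k * t powr \<nu>)"
  shows "M locally_integrable_on {0..}"
    and "\<And>t. t > 0 \<Longrightarrow> RL_integral_exists \<nu> M t"
    and "\<And>t. t > 0 \<Longrightarrow> M t - N\<^sub>0 * t powr (\<mu> - 1) = k * RL_integral \<nu> M t"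
proof -
  let ?F = "\<lambda>u. u powr (\<mu> - 1) * mittag_leffler \<nu> \<mu> (k * u powr \<nu>)"
  have MF: "N\<^sub>0 * Gamma \<mu> * ?F u = M u" if "u > 0" for u
    using M[OF that] by simp
  have ex: "RL_integral_exists \<rho> (\<lambda>u. N\<^sub>0 * Gamma \<mu> * ?F u) t" if "\<rho> > 0" "t > 0" for \<rho> t
    by (rule RL_integral_cmult(1), rule RL_integral_mittag_leffler(1)) (use \<nu> \<mu> that in auto)
  have exM: "RL_integral_exists \<rho> M t" if "\<rho> > 0" "t > 0" for \<rho> t
    using MF ex[OF that] by (rule RL_integral_cong(1))
  show "M locally_integrable_on {0..}"
    by (rule locally_integrable_if_RL_integral_exists_1) (rule exM, auto)
  fix t :: real assume t: "t > 0"
  show "RL_integral_exists \<nu> M t"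
    by (rule exM[OF \<nu> t])
  have "RL_integral \<nu> M t = RL_integral \<nu> (\<lambda>u. N\<^sub>0 * Gamma \<mu> * ?F u) t"
    using MF ex[OF \<nu> t] by (rule RL_integral_cong(2))
  also have "\<dots> = N\<^sub>0 * Gamma \<mu> * (t powr (\<mu> + \<nu> - 1) * mittag_leffler \<nu> (\<mu> + \<nu>) (k * t powr \<nu>))"
    unfolding RL_integral_cmult(2) RL_integral_mittag_leffler(2)[OF \<nu> \<mu> \<nu> t] ..
  also have "t powr (\<mu> + \<nu> - 1) = t powr (\<mu> - 1) * t powr \<nu>"
    by (simp add: powr_add[symmetric] algebra_simps)
  finally have RL: "RL_integral \<nu> M t =
      N\<^sub>0 * Gamma \<mu> * t powr (\<mu> - 1) * t powr \<nu> * mittag_leffler \<nu> (\<nu> + \<mu>) (k * t powr \<nu>)"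
    by (simp add: mult_ac add.commute)
  show "M t - N\<^sub>0 * t powr (\<mu> - 1) = k * RL_integral \<nu> M t"
    unfolding RL M[OF t] mittag_leffler_recurrence[OF \<nu> \<mu>, of "k * t powr \<nu>"]
    using Gamma_real_pos[OF \<mu>] by (simp add: algebra_simps)
qed

section \<open>Uniqueness for the homogeneous Abel-Volterra equation\<close>

text \<open>
  The Laplace transform of the power kernel, from Euler's integral for \<open>Gamma\<close> by rescaling.
\<close>

lemma nn_integral_exp_powr:
  fixes \<nu> s :: real
  assumes "\<nu> > 0" "s > 0"
  shows "(\<integral>\<^sup>+w. ennreal (indicator {0..} w * w powr (\<nu> - 1) * exp (- s * w)) \<partial>lborel)
           = ennreal (Gamma \<nu> / s powr \<nu>)"
proof -
  let ?I = "\<integral>\<^sup>+w. ennreal (indicator {0..} w * w powr (\<nu> - 1) * exp (- s * w)) \<partial>lborel"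
  have eq: "indicator {0..} (0 + s * w) * (0 + s * w) powr (\<nu> - 1) / exp (0 + s * w)
      = s powr (\<nu> - 1) * (indicator {0..} w * w powr (\<nu> - 1) * exp (- s * w))" for w :: real
    using assms by (auto simp: indicator_def powr_mult exp_minus field_simps zero_le_mult_iff)
  have "ennreal (Gamma \<nu>) = ennreal \<bar>s\<bar> * (\<integral>\<^sup>+w. ennreal
      (indicator {0..} (0 + s * w) * (0 + s * w) powr (\<nu> - 1) / exp (0 + s * w)) \<partial>lborel)"
    unfolding Gamma_conv_nn_integral_real[OF assms(1)]
    by (rule nn_integral_real_affine) (use assms in auto)
  also have "\<dots> = ennreal s * (ennreal (s powr (\<nu> - 1)) * ?I)"
    unfolding eq using assms by (simp add: ennreal_mult' nn_integral_cmult)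
  also have "\<dots> = ennreal (s powr \<nu>) * ?I"
    using assms powr_add[of s 1 "\<nu> - 1"] by (simp add: mult.assoc[symmetric] ennreal_mult'[symmetric])
  finally have "ennreal (1 / s powr \<nu>) * ennreal (Gamma \<nu>) = ennreal (1 / s powr \<nu>) * (ennreal (s powr \<nu>) * ?I)"
    by simp
  thus ?thesis
    using assms by (simp add: mult.assoc[symmetric] ennreal_mult'[symmetric])
qed

text \<open>
  Weighting by \<open>exp (- s * t)\<close> makes the Volterra operator a contraction in \<open>L\<^sup>1\<close>. Let \<open>A\<close> be the
  integral of \<open>exp (- s * t) * \<bar>D t\<bar>\<close> over \<open>{0..T}\<close>. Taking absolute values in the equation bounds the weighted
  solution by \<open>k / Gamma \<nu>\<close> times its convolution with the damped kernel; by Tonelli the integral of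
  that convolution is \<open>A\<close> times the mass of the damped kernel \<open>w powr (\<nu> - 1) * exp (- s * w)\<close>. For large \<open>s\<close>
  this gives \<open>A \<le> A / 2\<close>.
\<close>

lemma homogeneous_abel_volterra_zero:
  fixes D :: "real \<Rightarrow> real" and \<nu> k :: real
  assumes \<nu>: "\<nu> > 0" and k: "k > 0"
    and loc: "D locally_integrable_on {0..}"
    and ex: "\<And>t. t > 0 \<Longrightarrow> RL_integral_exists \<nu> D t"
    and eq: "\<And>t. t > 0 \<Longrightarrow> D t = - k * RL_integral \<nu> D t"
    and T: "T > 0"
  shows "D T = 0"
proof -
  \<comment> \<open>With this rate, \<open>k / Gamma \<nu>\<close> times the mass \<open>Gamma \<nu> / s powr \<nu>\<close> of the damped kernel is \<open>1/2\<close>.\<close>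
  define s where "s = (2 * k) powr (1 / \<nu>)"
  have s: "s > 0" and s\<nu>: "s powr \<nu> = 2 * k"
    using \<nu> k by (auto simp: s_def powr_powr)
  define d where "d = (\<lambda>u. indicator {0..T} u *\<^sub>R D u)"
  have int_d: "integrable lebesgue d"
    using loc unfolding locally_integrable_on_def d_def set_integrable_def[symmetric] by auto
  \<comment> \<open>The solution is only Lebesgue measurable, whereas the product measure in Tonelli's theorem
    needs Borel functions; \<open>g\<close> is a Borel representative of the truncated solution.\<close>
  obtain g where g[measurable]: "g \<in> borel_measurable lborel" and dg: "AE u in lborel. d u = g u"
    using completion_ex_borel_measurable_real[OF borel_measurable_integrable[OF int_d]] by auto
  have g'[measurable]: "g \<in> borel_measurable borel" using g by simp
  define h where "h = (\<lambda>u. ennreal (exp (- s * u) * \<bar>g u\<bar>))"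
  define \<kappa> where "\<kappa> = (\<lambda>w. ennreal (indicator {0..} w * w powr (\<nu> - 1) * exp (- s * w)))"
  have [measurable]: "h \<in> borel_measurable borel" "\<kappa> \<in> borel_measurable borel"
    unfolding h_def \<kappa>_def by measurable
  define A where "A = (\<integral>\<^sup>+u. h u \<partial>lborel)"
  have "A \<le> (\<integral>\<^sup>+u. ennreal (norm (d u)) \<partial>lborel)"
    unfolding A_def
  proof (rule nn_integral_mono_AE, use dg in eventually_elim)
    fix u assume "d u = g u"
    moreover have "exp (- s * u) * \<bar>d u\<bar> \<le> \<bar>d u\<bar>"
      using s by (cases "u \<in> {0..T}") (auto simp: d_def intro!: mult_left_le_one_le)
    ultimately show "h u \<le> ennreal (norm (d u))"
      by (simp add: h_def ennreal_leI)
  qed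
  also have "\<dots> = (\<integral>\<^sup>+u. ennreal (norm (d u)) \<partial>lebesgue)"
    by (rule nn_integral_completion[symmetric])
  also have "\<dots> < \<infinity>"
    using int_d by (simp add: integrable_iff_bounded)
  finally have A_fin: "A < \<infinity>" .
  \<comment> \<open>The weight is multiplicative, \<open>exp (- s * t) = exp (- s * u) * exp (- s * (t - u))\<close>, so it
    splits between the solution and the kernel and leaves a convolution.\<close>
  have bound: "AE t in lborel. h t \<le> ennreal (k / Gamma \<nu>) * (\<integral>\<^sup>+u. h u * \<kappa> (t - u) \<partial>lborel)"
    using dg AE_lborel_singleton[of 0]
  proof eventually_elim
    fix t assume dgt: "d t = g t" and t0: "t \<noteq> 0"
    show "h t \<le> ennreal (k / Gamma \<nu>) * (\<integral>\<^sup>+u. h u * \<kappa> (t - u) \<partial>lborel)"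
    proof (cases "t \<in> {0..T}")
      case False
      thus ?thesis using dgt by (simp add: h_def d_def)
    next
      case True
      hence t: "t > 0" "t \<le> T" using t0 by auto
      let ?q = "\<lambda>u. indicator {0..t} u *\<^sub>R (D u * (t - u) powr (\<nu> - 1))"
      have int_q: "integrable lebesgue ?q"
        using ex[OF t(1)] by (simp add: RL_integral_exists_def set_integrable_def)
      have "g t = - k * (1 / Gamma \<nu> * integral\<^sup>L lebesgue ?q)"
        using eq[OF t(1)] dgt True
        by (simp add: d_def RL_integral_def set_lebesgue_integral_def)
      hence "\<bar>g t\<bar> = k / Gamma \<nu> * \<bar>integral\<^sup>L lebesgue ?q\<bar>"
        using k Gamma_real_pos[OF \<nu>] by (simp add: abs_mult)
      hence "h t = ennreal (k / Gamma \<nu>) * (ennreal (exp (- s * t)) * ennreal (norm (integral\<^sup>L lebesgue ?q)))"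
        using k Gamma_real_pos[OF \<nu>] by (simp add: h_def ennreal_mult'[symmetric] mult_ac)
      also have "\<dots> \<le> ennreal (k / Gamma \<nu>) * (ennreal (exp (- s * t)) * (\<integral>\<^sup>+u. ennreal (norm (?q u)) \<partial>lebesgue))"
        by (intro mult_left_mono integral_norm_bound_ennreal int_q) auto
      also have "ennreal (exp (- s * t)) * (\<integral>\<^sup>+u. ennreal (norm (?q u)) \<partial>lebesgue)
          = (\<integral>\<^sup>+u. ennreal (exp (- s * t)) * ennreal (norm (?q u)) \<partial>lebesgue)"
        using int_q by (intro nn_integral_cmult[symmetric]) auto
      also have "\<dots> = (\<integral>\<^sup>+u. ennreal (exp (- s * t)) * ennreal (norm (?q u)) \<partial>lborel)"
        by (rule nn_integral_completion)
      also have "\<dots> \<le> (\<integral>\<^sup>+u. h u * \<kappa> (t - u) \<partial>lborel)"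
      proof (rule nn_integral_mono_AE, use dg in eventually_elim)
        fix u assume dgu: "d u = g u"
        show "ennreal (exp (- s * t)) * ennreal (norm (?q u)) \<le> h u * \<kappa> (t - u)"
        proof (cases "u \<in> {0..t}")
          case u: True
          have "exp (- s * t) = exp (- s * u) * exp (- s * (t - u))"
            by (simp add: exp_add[symmetric] algebra_simps)
          moreover have "g u = D u"
            using dgu u t by (simp add: d_def)
          ultimately show ?thesis
            using u by (simp add: h_def \<kappa>_def ennreal_mult'[symmetric] abs_mult mult_ac)
        qed simp
      qed
      finally show ?thesis by (simp add: mult_left_mono)
    qed
  qed
  have "A \<le> (\<integral>\<^sup>+t. ennreal (k / Gamma \<nu>) * (\<integral>\<^sup>+u. h u * \<kappa> (t - u) \<partial>lborel) \<partial>lborel)"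
    unfolding A_def by (rule nn_integral_mono_AE[OF bound])
  also have "\<dots> = ennreal (k / Gamma \<nu>) * (\<integral>\<^sup>+t. \<integral>\<^sup>+u. h u * \<kappa> (t - u) \<partial>lborel \<partial>lborel)"
    by (rule nn_integral_cmult) measurable
  also have "(\<integral>\<^sup>+t. \<integral>\<^sup>+u. h u * \<kappa> (t - u) \<partial>lborel \<partial>lborel) = (\<integral>\<^sup>+u. \<integral>\<^sup>+t. h u * \<kappa> (t - u) \<partial>lborel \<partial>lborel)"
    by (rule lborel_pair.Fubini') measurable
  also have "\<dots> = (\<integral>\<^sup>+u. h u * ennreal (Gamma \<nu> / s powr \<nu>) \<partial>lborel)"
  proof (rule nn_integral_cong)
    fix u :: real
    have "(\<integral>\<^sup>+t. \<kappa> (t - u) \<partial>lborel) = (\<integral>\<^sup>+w. \<kappa> w \<partial>lborel)"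
      using nn_integral_real_affine[of \<kappa> 1 "- u"] by simp
    also have "\<dots> = ennreal (Gamma \<nu> / s powr \<nu>)"
      unfolding \<kappa>_def by (rule nn_integral_exp_powr[OF \<nu> s])
    finally show "(\<integral>\<^sup>+t. h u * \<kappa> (t - u) \<partial>lborel) = h u * ennreal (Gamma \<nu> / s powr \<nu>)"
      by (simp add: nn_integral_cmult)
  qed
  also have "\<dots> = A * ennreal (Gamma \<nu> / s powr \<nu>)"
    unfolding A_def by (rule nn_integral_multc) measurable
  also have "ennreal (k / Gamma \<nu>) * (A * ennreal (Gamma \<nu> / s powr \<nu>)) = ennreal (1 / 2) * A"
    using k Gamma_real_pos[OF \<nu>]
    by (simp add: s\<nu> mult.left_commute[of _ A] mult.commute[of _ A] ennreal_mult'[symmetric])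
  finally have A_half: "A \<le> ennreal (1 / 2) * A" .
  \<comment> \<open>Finiteness of \<open>A\<close> is what excludes the other fixed point, \<open>\<infinity>\<close>.\<close>
  have "A = 0"
  proof -
    obtain r where r: "A = ennreal r" "r \<ge> 0" using A_fin by (cases A) auto
    hence "ennreal r \<le> ennreal (1 / 2 * r)"
      using A_half by (metis ennreal_mult' zero_le_divide_1_iff zero_le_numeral)
    hence "r \<le> 1 / 2 * r"
      using r(2) ennreal_le_iff[of "1 / 2 * r" r] by linarith
    thus ?thesis using r by simp
  qed
  hence "AE u in lborel. h u = 0"
    unfolding A_def by (subst (asm) nn_integral_0_iff_AE) auto
  hence "AE u in lborel. d u = 0"
    using dg by eventually_elim (simp add: h_def)
  hence "AE u in lebesgue. d u = 0"
    by (rule AE_completion)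
  hence "AE u in lebesgue. indicator {0..T} u *\<^sub>R (D u * (T - u) powr (\<nu> - 1)) = 0"
    by eventually_elim (auto simp: d_def indicator_def)
  \<comment> \<open>The integral equation at \<open>T\<close> turns vanishing almost everywhere into vanishing at \<open>T\<close>.\<close>
  hence "RL_integral \<nu> D T = 0"
    unfolding RL_integral_def set_lebesgue_integral_def by (simp add: integral_eq_zero_AE)
  thus ?thesis using eq[OF T] by simp
qed

section \<open>The solution of the fractional kinetic equation\<close>

theorem theorem1:
  fixes \<nu> \<mu> c N\<^sub>0 :: real and N :: "real \<Rightarrow> real"
  assumes "\<nu> > 0" and "\<mu> > 0" and "c > 0"
  shows "(N locally_integrable_on {0..} \<and>
          (\<forall>t>0. RL_integral_exists \<nu> N t \<and>
                 N t - N\<^sub>0 * t powr (\<mu> - 1) = - (c powr \<nu>) * RL_integral \<nu> N t))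
         \<longleftrightarrow>
         (\<forall>t>0. N t = N\<^sub>0 * Gamma \<mu> * t powr (\<mu> - 1)
                        * mittag_leffler \<nu> \<mu> (- (c powr \<nu>) * t powr \<nu>))"
    (is "?L \<longleftrightarrow> ?R")
proof
  assume ?R
  thus ?L
    using mittag_leffler_solves[OF assms(1,2), of N N\<^sub>0 "- (c powr \<nu>)"] by blast
next
  assume L: ?L
  define M where "M = (\<lambda>t. N\<^sub>0 * Gamma \<mu> * t powr (\<mu> - 1) * mittag_leffler \<nu> \<mu> (- (c powr \<nu>) * t powr \<nu>))"
  note sol = mittag_leffler_solves[OF assms(1,2), of M N\<^sub>0 "- (c powr \<nu>)", OF fun_cong[OF M_def]]
  show ?R
  proof (intro allI impI)
    fix t :: real assume t: "t > 0"
    have "N t - M t = 0"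
    proof (rule homogeneous_abel_volterra_zero[where D = "\<lambda>t. N t - M t" and k = "c powr \<nu>"])
      show "(\<lambda>t. N t - M t) locally_integrable_on {0..}"
        using L sol(1) unfolding locally_integrable_on_def by (auto intro: set_integral_diff(1))
      fix r :: real assume r: "r > 0"
      have ex: "RL_integral_exists \<nu> N r" using L r by blast
      show "RL_integral_exists \<nu> (\<lambda>t. N t - M t) r"
        by (rule RL_integral_diff(1)[OF ex sol(2)[OF r]])
      have "N r - N\<^sub>0 * r powr (\<mu> - 1) = - (c powr \<nu>) * RL_integral \<nu> N r" using L r by blast
      thus "N r - M r = - (c powr \<nu>) * RL_integral \<nu> (\<lambda>t. N t - M t) r"
        unfolding RL_integral_diff(2)[OF ex sol(2)[OF r]]
        using sol(3)[OF r] by (simp add: algebra_simps)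
    qed (use assms t in auto)
    thus "N t = N\<^sub>0 * Gamma \<mu> * t powr (\<mu> - 1) * mittag_leffler \<nu> \<mu> (- (c powr \<nu>) * t powr \<nu>)"
      by (simp add: M_def)
  qed
qed

end
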